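(* Let $\mathcal{A},\mathcal{B}\subseteq\mathcal{P}_\infty(\mathbb{N})$ be hereditary families with $\mathcal{A}\perp\mathcal{B}$. Assume $\mathcal{A}$ is analytic and $\mathcal{B}$ is $C$-measurable and an M-family. Then either (i) $\mathcal{A}$ is countably generated in $\mathcal{B}^\perp$, or (ii) there exists a one-to-one map $\psi:\mathbb{N}^{<\mathbb{N}}\to\mathbb{N}$ such that $\mathcal{C}\subseteq\{\psi^{-1}(A):A\in\mathcal{A}\}$ and $\mathcal{I}_{\mathrm{wf}}\subseteq\{\psi^{-1}(B):B\in\mathcal{B}^{\perp\perp}\}$.
   Context: $\mathcal{P}_\infty(X)$: infinite subsets of countable $X$, with the topology of $2^X$. $C$-measurable: in the smallest $\sigma$-algebra containing open sets and closed under the Souslin operation. Hereditary: closed under passing to infinite subsets. An M-family is a hereditary family $\mathcal{A}$ such that for every sequence $(A_n)_n$ in $\mathcal{A}$ there is $A\in\mathcal{A}$ with $A\setminus\bigcup_{i\ge n}A_i$ finite for every $n$. $A\perp B$ means $A\cap B$ finite; $\mathcal{A}\perp\mathcal{B}$ means pairwise; $\mathcal{A}^\perp=\{B\in\mathcal{P}_\infty(X):B\perp A\ \forall A\in\mathcal{A}\}$, $\mathcal{B}^{\perp\perp}=(\mathcal{B}^\perp)^\perp$. $\mathcal{A}$ is countably generated in $\mathcal{D}$ if there are $D_n\in\mathcal{D}$ with every $A\in\mathcal{A}$ satisfying $A\setminus D_n$ finite for some $n$. $\mathbb{N}^{<\mathbb{N}}$ is the tree of finite sequences of naturals ordered by end-extension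 $\sqsubset$. $\mathcal{C}$ is the family of infinite chains of $\mathbb{N}^{<\mathbb{N}}$ (infinite subsets linearly ordered by $\sqsubset$). $\mathrm{WF}$ is the set of downwards closed, well-founded (no infinite branch), infinite subtrees of $\mathbb{N}^{<\mathbb{N}}$, and $\mathcal{I}_{\mathrm{wf}}=\{W\in\mathcal{P}_\infty(\mathbb{N}^{<\mathbb{N}}):\exists T\in\mathrm{WF},\ W\subseteq T\}$.
   Formalization: "Countably generated in D" is read with a countable, possibly empty, subfamily of D; with a sequence D_n in D the claim fails for A empty and B all infinite sets (B^perp is empty). The two readings differ only if both A and B^perp are empty. *)

theory Defs
  imports Main "HOL-Library.Sublist" "HOL-Library.Countable_Set"
begin

definition Pinf :: "nat set set" where
  "Pinf = {A. infinite A}"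

text \<open>Open sets of the Cantor space 2^N (product topology), sets identified with
  their characteristic functions.\<close>
definition cantor_open :: "nat set set \<Rightarrow> bool" where
  "cantor_open U \<longleftrightarrow> (\<forall>S\<in>U. \<exists>n. \<forall>T. T \<inter> {..<n} = S \<inter> {..<n} \<longrightarrow> T \<in> U)"

definition baire_cantor_continuous :: "((nat \<Rightarrow> nat) \<Rightarrow> nat set) \<Rightarrow> bool" where
  "baire_cantor_continuous f \<longleftrightarrow>
     (\<forall>x n. \<exists>m. \<forall>y. (\<forall>i<m. y i = x i) \<longrightarrow> f y \<inter> {..<n} = f x \<inter> {..<n})"

definition analytic :: "nat set set \<Rightarrow> bool" where
  "analytic A \<longleftrightarrow> A = {} \<or> (\<exists>f. baire_cantor_continuous f \<and> range f = A)"

inductive_set Cmeasurable :: "nat set set set" where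
  open_set: "cantor_open V \<Longrightarrow> V \<inter> Pinf \<in> Cmeasurable"
| compl: "A \<in> Cmeasurable \<Longrightarrow> Pinf - A \<in> Cmeasurable"
| countable_union: "(\<And>n::nat. F n \<in> Cmeasurable) \<Longrightarrow> (\<Union>n. F n) \<in> Cmeasurable"
| souslin: "(\<And>s::nat list. P s \<in> Cmeasurable) \<Longrightarrow>
              (\<Union>\<sigma>::nat \<Rightarrow> nat. \<Inter>n. P (map \<sigma> [0..<Suc n])) \<in> Cmeasurable"

definition hereditary :: "'a set set \<Rightarrow> bool" where
  "hereditary F \<longleftrightarrow> (\<forall>A\<in>F. \<forall>B. B \<subseteq> A \<and> infinite B \<longrightarrow> B \<in> F)"

definition M_family :: "nat set set \<Rightarrow> bool" where
  "M_family F \<longleftrightarrow> hereditary F \<and>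
     (\<forall>An::nat \<Rightarrow> nat set. (\<forall>n. An n \<in> F) \<longrightarrow> (\<exists>A\<in>F. \<forall>n. finite (A - (\<Union>i\<in>{n..}. An i))))"

definition orth :: "'a set \<Rightarrow> 'a set \<Rightarrow> bool" where
  "orth A B \<longleftrightarrow> finite (A \<inter> B)"

definition orth_fam :: "'a set set \<Rightarrow> 'a set set \<Rightarrow> bool" where
  "orth_fam F G \<longleftrightarrow> (\<forall>A\<in>F. \<forall>B\<in>G. orth A B)"

definition perp :: "nat set set \<Rightarrow> nat set set" where
  "perp F = {B \<in> Pinf. \<forall>A\<in>F. orth B A}"

definition countably_generated_in :: "'a set set \<Rightarrow> 'a set set \<Rightarrow> bool" where
  "countably_generated_in F D \<longleftrightarrow>
     (\<exists>D0. countable D0 \<and> D0 \<subseteq> D \<and> (\<forall>A\<in>F. \<exists>E\<in>D0. finite (A - E)))"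

definition tree_chains :: "nat list set set" where
  "tree_chains = {C. infinite C \<and> (\<forall>s\<in>C. \<forall>t\<in>C. prefix s t \<or> prefix t s)}"

definition WF_trees :: "nat list set set" where
  "WF_trees = {T. infinite T \<and> (\<forall>s\<in>T. \<forall>t. prefix t s \<longrightarrow> t \<in> T)
                 \<and> \<not> (\<exists>\<sigma>::nat \<Rightarrow> nat. \<forall>n. map \<sigma> [0..<n] \<in> T)}"

definition I_wf :: "nat list set set" where
  "I_wf = {W. infinite W \<and> (\<exists>T\<in>WF_trees. W \<subseteq> T)}"

end

theory Submission
  imports Defs
begin

text \<open>
  Call a set of naturals positive if it has infinite intersection with some member of \<B>. Since \<B> is
  hereditary the positive sets form a coideal, and the M-property lets one diagonalise through
  countably many positive sets. Let f be a continuous surjection of the Baire space onto \<A>, and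
  suppose that \<A> is not countably generated in the orthogonal of \<B>. The pairs (u, n) such that n
  belongs to f x for all x extending u, and the image of the cylinder u is not countably generated,
  form a set which is big: above each of its members the values n make up a positive set.

  Big sets are partition regular. This is the pigeonhole principle of a Ramsey theorem of Ellentuck
  type, for infinite sequences of points taken from infinitely many columns, each column holding a
  big set. The sets with the Ramsey property are closed under complements, countable unions and the
  Souslin operation, so the C-measurable family \<B> can be decided; the M-property rules out the
  negative alternative. Hence above every point of a big set there is a sequence of big sets such
  that all sets meeting infinitely many of them are positive. Iterating along the tree of finite
  sequences gives the embedding: a branch yields an infinite subset of some f x, and an infinite
  subset of a well-founded tree contains, by Koenig's lemma, an infinite fan, whose image is positive.
\<close>

section \<open>A Ramsey theorem for columns of partition regular sets\<close>

abbreviation pre :: "(nat \<Rightarrow> 'b) \<Rightarrow> nat \<Rightarrow> 'b list" where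
  "pre z k \<equiv> map z [0..<k]"

lemma pre_eq_iff: "pre y k = pre z k \<longleftrightarrow> (\<forall>i<k. y i = z i)"
  by auto

text \<open>Reversal puts the last entry outermost in \<open>list_encode\<close>, so that appending
  an entry increases the code. Injectivity leaves only finitely many stems below each bound, as the
  fusion needs.\<close>

definition weight :: "'b::countable list \<Rightarrow> nat" where
  "weight b = list_encode (rev (map to_nat b))"

lemma inj_weight: "inj weight"
  by (rule injI) (simp add: weight_def list_encode_eq)

lemma weight_snoc: "weight b < weight (b @ [x])"
  using le_prod_encode_2[of "list_encode (rev (map to_nat b))" "to_nat x"]
  by (simp add: weight_def)

lemma weight_pre_mono: "k \<le> l \<Longrightarrow> weight (pre z k) \<le> weight (pre z l)"
proof (induction l rule: dec_induct)
  case (step l)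
  then show ?case using weight_snoc[of "pre z l" "z l"] by simp
qed simp

lemma finite_weight_less: "finite {b. weight b < n}"
  using finite_vimageI[OF finite_lessThan inj_weight, of n] by (simp add: vimage_def)

text \<open>\<open>P\<close> will be the family of big sets and \<open>P_split\<close> their
  pigeonhole principle. It asks for members of \<open>P\<close> inside the two halves, since
  \<open>P\<close> need not be closed under supersets.\<close>

locale column_ramsey =
  fixes P :: "'a::countable set set"
  assumes P_nonempty: "p \<in> P \<Longrightarrow> p \<noteq> {}"
    and P_split: "p \<in> P \<Longrightarrow> (\<exists>q\<in>P. q \<subseteq> p \<inter> C) \<or> (\<exists>q\<in>P. q \<subseteq> p - C)"
begin

section \<open>Conditions and the neighbourhoods they span\<close>

definition cond :: "(nat \<times> 'a) set \<Rightarrow> bool" where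
  "cond E \<longleftrightarrow> infinite (fst ` E) \<and> (\<forall>n\<in>fst ` E. E `` {n} \<in> P)"

text \<open>
  The entries after the stem b lie in E and are sparse relative to the columns of E itself: some column
  of E separates each entry from (the code of) everything before it. Sparseness relative to a fixed
  growth rate would not survive the diagonalisation below, because columns are infinite.
\<close>
definition nbhd :: "(nat \<times> 'a) list \<Rightarrow> (nat \<times> 'a) set \<Rightarrow> (nat \<Rightarrow> nat \<times> 'a) set" where
  "nbhd b E = {z. pre z (length b) = b \<and>
     (\<forall>k\<ge>length b. z k \<in> E \<and> (\<exists>d\<in>fst ` E. weight (pre z k) < d \<and> d < fst (z k)))}"

lemma nbhd_mono: "F \<subseteq> E \<Longrightarrow> nbhd b F \<subseteq> nbhd b E"
  unfolding nbhd_def using image_mono[of F E fst] by blast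

lemma pre_mem_nbhd: "z \<in> nbhd b E \<Longrightarrow> length b \<le> k \<Longrightarrow> z \<in> nbhd (pre z k) E"
  unfolding nbhd_def by simp

lemma nbhd_pre_length: "z \<in> nbhd b E \<Longrightarrow> pre z (length b) = b"
  unfolding nbhd_def by simp

lemma nbhd_mem: "z \<in> nbhd b E \<Longrightarrow> length b \<le> k \<Longrightarrow> z k \<in> E"
  unfolding nbhd_def by simp

lemma nbhd_pre_subset:
  assumes z: "z \<in> nbhd b E" and k: "length b \<le> k"
  shows "nbhd (pre z k) E \<subseteq> nbhd b E"
proof
  fix y assume y: "y \<in> nbhd (pre z k) E"
  then have yz: "pre y k = pre z k" using nbhd_pre_length[OF y] by simp
  have eq: "pre y j = pre z j" if "j \<le> k" for j
    using yz that by (simp add: pre_eq_iff)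
  have "y j \<in> E \<and> (\<exists>d\<in>fst ` E. weight (pre y j) < d \<and> d < fst (y j))" if "length b \<le> j" for j
  proof (cases "j < k")
    case True
    then have "y j = z j" "pre y j = pre z j" using yz eq[of j] by simp_all
    moreover have "z j \<in> E \<and> (\<exists>d\<in>fst ` E. weight (pre z j) < d \<and> d < fst (z j))"
      using z that unfolding nbhd_def by blast
    ultimately show ?thesis by metis
  next
    case False
    then show ?thesis using y unfolding nbhd_def by auto
  qed
  moreover have "pre y (length b) = b"
    using eq[OF k] nbhd_pre_length[OF z] by simp
  ultimately show "y \<in> nbhd b E" unfolding nbhd_def by blast
qed

text \<open>Recursion on the stem: columns are unbounded, so one of them can be placed between the
  code of the stem and the next entry. The predicate \<open>Q\<close> lets later arguments steer
  each new entry in view of the ones before.\<close>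

lemma nbhd_exists:
  assumes E: "infinite (fst ` E)"
    and Q: "\<And>c n. \<exists>y\<in>E. n < fst y \<and> Q c y"
  shows "\<exists>z\<in>nbhd b E. \<forall>k\<ge>length b. Q (pre z k) (z k)"
proof -
  have step: "\<exists>y\<in>E. (\<exists>d\<in>fst ` E. weight c < d \<and> d < fst y) \<and> Q c y" for c
  proof -
    obtain d where "d \<in> fst ` E" "weight c < d"
      using E unfolding infinite_nat_iff_unbounded by blast
    then show ?thesis using Q[of d c] by blast
  qed
  define nxt where "nxt c = (SOME y. y \<in> E \<and> (\<exists>d\<in>fst ` E. weight c < d \<and> d < fst y) \<and> Q c y)" for c
  have nxt: "nxt c \<in> E \<and> (\<exists>d\<in>fst ` E. weight c < d \<and> d < fst (nxt c)) \<and> Q c (nxt c)" for c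
    unfolding nxt_def by (rule someI_ex) (use step in blast)
  define S where "S = rec_nat b (\<lambda>_ c. c @ [nxt c])"
  have S0: "S 0 = b" and SS: "S (Suc n) = S n @ [nxt (S n)]" for n
    by (simp_all add: S_def)
  have lenS: "length (S n) = length b + n" for n
    by (induction n) (simp_all add: S0 SS)
  have stab: "S (n + m) ! i = S n ! i" if "i < length b + n" for n m i
    by (induction m) (use that lenS in \<open>simp_all add: SS nth_append\<close>)
  \<comment> \<open>Stage \<open>Suc i\<close> is long enough to have an entry at position
    \<open>i\<close> even when \<open>b\<close> is empty, and later stages keep that entry.\<close>
  define z where "z i = S (Suc i) ! i" for i
  have zS: "pre z (length b + n) = S n" for n
  proof (rule nth_equalityI)
    fix i assume "i < length (pre z (length b + n))"
    then have i: "i < length b + n" by simp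
    then have "pre z (length b + n) ! i = S (Suc i) ! i" by (simp add: z_def)
    also have "\<dots> = S (Suc i + n) ! i" using stab[of i "Suc i" n] by simp
    also have "\<dots> = S n ! i" using stab[of i n "Suc i"] i by (simp add: add.commute)
    finally show "pre z (length b + n) ! i = S n ! i" .
  qed (simp add: lenS)
  have z_nxt: "z k = nxt (pre z k)" if "length b \<le> k" for k
  proof -
    define n where "n = k - length b"
    have k: "k = length b + n" using that by (simp add: n_def)
    have "pre z (length b + Suc n) = pre z (length b + n) @ [nxt (pre z (length b + n))]"
      using zS[of "Suc n"] zS[of n] SS[of n] by simp
    then show ?thesis by (simp add: k)
  qed
  have "z \<in> nbhd b E"
    unfolding nbhd_def using zS[of 0] S0 nxt z_nxt by simp
  moreover have "\<forall>k\<ge>length b. Q (pre z k) (z k)" using nxt z_nxt by metis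
  ultimately show ?thesis by blast
qed

lemma nbhd_nonempty:
  assumes "cond E" shows "nbhd b E \<noteq> {}"
proof -
  have inf: "infinite (fst ` E)" using assms by (simp add: cond_def)
  then have "\<exists>y\<in>E. n < fst y \<and> True" for n
    unfolding infinite_nat_iff_unbounded by blast
  from nbhd_exists[OF inf this, of b] show ?thesis by blast
qed

lemma cond_tail:
  assumes "cond E" shows "cond {y\<in>E. n < fst y}"
proof -
  have eq: "fst ` {y\<in>E. n < fst y} = fst ` E - {..n}" by force
  have "{y\<in>E. n < fst y} `` {m} = E `` {m}" if "m > n" for m using that by auto
  then show ?thesis using assms unfolding cond_def eq by auto
qed

text \<open>The pigeonhole principle is applied in each column separately; infinitely many columns
  then choose the same side.\<close>

lemma cond_split:
  assumes E: "cond E"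
  shows "\<exists>G\<subseteq>E. cond G \<and> (G \<subseteq> C \<or> G \<inter> C = {})"
proof -
  define N where "N K = {n\<in>fst ` E. \<exists>q\<in>P. q \<subseteq> E `` {n} \<inter> K `` {n}}" for K
  have sub: "\<exists>G\<subseteq>E. cond G \<and> G \<subseteq> K" if inf: "infinite (N K)" for K
  proof -
    have "\<forall>n\<in>N K. \<exists>q. q \<in> P \<and> q \<subseteq> E `` {n} \<inter> K `` {n}" unfolding N_def by blast
    then obtain q where q: "\<And>n. n \<in> N K \<Longrightarrow> q n \<in> P" "\<And>n. n \<in> N K \<Longrightarrow> q n \<subseteq> E `` {n} \<inter> K `` {n}"
      by metis
    have fG: "fst ` Sigma (N K) q = N K"
      using q(1) P_nonempty by (force simp: image_iff)
    have "Sigma (N K) q `` {n} = q n" if "n \<in> N K" for n using that by auto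
    then have "cond (Sigma (N K) q)" unfolding cond_def fG using inf q by simp
    moreover have "Sigma (N K) q \<subseteq> E" "Sigma (N K) q \<subseteq> K" using q(2) by blast+
    ultimately show ?thesis by blast
  qed
  have "n \<in> N C \<union> N (- C)" if n: "n \<in> fst ` E" for n
  proof -
    have p: "E `` {n} \<in> P" using E n unfolding cond_def by blast
    have "E `` {n} - C `` {n} = E `` {n} \<inter> (- C) `` {n}" by blast
    then show ?thesis using P_split[OF p, of "C `` {n}"] n unfolding N_def by auto
  qed
  then have "fst ` E \<subseteq> N C \<union> N (- C)" by blast
  then have "infinite (N C) \<or> infinite (N (- C))"
    using E unfolding cond_def by (meson finite_Un finite_subset)
  then show ?thesis using sub[of C] sub[of "- C"] by blast
qed

text \<open>The relation in which a fusion is below the stages of its construction.\<close>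
definition almost :: "(nat \<times> 'a) list \<Rightarrow> (nat \<times> 'a) set \<Rightarrow> (nat \<times> 'a) set \<Rightarrow> bool" where
  "almost b G F \<longleftrightarrow> nbhd b G \<subseteq> nbhd b F \<and> (\<exists>n. {y\<in>G. n < fst y} \<subseteq> F)"

lemma subset_almost: "G \<subseteq> F \<Longrightarrow> almost b G F"
  unfolding almost_def using nbhd_mono by blast

section \<open>Fusion of countably many dense requirements\<close>

lemma cond_finite_dense:
  assumes "finite S" "cond E"
    and "\<And>i F. i \<in> S \<Longrightarrow> cond F \<Longrightarrow> F \<subseteq> E \<Longrightarrow> \<exists>G\<subseteq>F. cond G \<and> \<Psi> i G"
    and "\<And>i F G. i \<in> S \<Longrightarrow> cond F \<Longrightarrow> \<Psi> i F \<Longrightarrow> cond G \<Longrightarrow> G \<subseteq> F \<Longrightarrow> \<Psi> i G"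
  shows "\<exists>G\<subseteq>E. cond G \<and> (\<forall>i\<in>S. \<Psi> i G)"
  using assms
proof (induction S rule: finite_induct)
  case (insert i S)
  have "\<exists>G\<subseteq>E. cond G \<and> (\<forall>i\<in>S. \<Psi> i G)"
  proof (rule insert.IH[OF insert.prems(1)])
    fix k F assume "k \<in> S" "cond F" "F \<subseteq> E"
    then show "\<exists>G\<subseteq>F. cond G \<and> \<Psi> k G" by (intro insert.prems(2)) simp_all
  next
    fix k F G assume "k \<in> S" "cond F" "\<Psi> k F" "cond G" "G \<subseteq> F"
    then show "\<Psi> k G" using insert.prems(3)[of k F G] by simp
  qed
  then obtain G where G: "G \<subseteq> E" "cond G" "\<And>k. k \<in> S \<Longrightarrow> \<Psi> k G" by blast
  obtain H where H: "H \<subseteq> G" "cond H" "\<Psi> i H"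
    using insert.prems(2)[of i G] G by blast
  have "\<Psi> k H" if "k \<in> insert i S" for k
  proof (cases "k = i")
    case False
    then show ?thesis using insert.prems(3)[of k G H] G H that by simp
  qed (use H in simp)
  then show ?case using G(1) H by blast
qed blast

text \<open>Stage \<open>Suc n\<close> meets the requirements of the finitely many stems of weight
  below \<open>d n\<close>, and the limit \<open>G\<close> keeps from stage \<open>n\<close> only
  the column \<open>d n\<close>. For the least \<open>i\<close> with \<open>weight b < d i\<close>,
  sparseness forces all entries after \<open>b\<close> beyond column \<open>d i\<close>, hence into
  stage \<open>Suc i\<close>.\<close>

lemma fusion:
  assumes E: "cond E"
    and dense: "\<And>b F. cond F \<Longrightarrow> F \<subseteq> E \<Longrightarrow> \<exists>G\<subseteq>F. cond G \<and> \<Phi> b G"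
    and inv: "\<And>b F G. cond F \<Longrightarrow> \<Phi> b F \<Longrightarrow> cond G \<Longrightarrow> almost b G F \<Longrightarrow> \<Phi> b G"
  shows "\<exists>G\<subseteq>E. cond G \<and> (\<forall>b. \<Phi> b G)"
proof -
  \<comment> \<open>A state pairs a condition with one of its columns. The last clause reserves a
    further column of the new condition between the old and the new selected ones.\<close>
  define R where "R s t \<longleftrightarrow> fst t \<subseteq> fst s \<and> (\<forall>b. weight b < snd s \<longrightarrow> \<Phi> b (fst t)) \<and>
    (\<exists>d\<in>fst ` fst t. snd s < d \<and> d < snd t)" for s t :: "(nat \<times> 'a) set \<times> nat"
  define I where "I s \<longleftrightarrow> cond (fst s) \<and> fst s \<subseteq> E \<and> snd s \<in> fst ` fst s"
    for s :: "(nat \<times> 'a) set \<times> nat"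
  have start: "\<exists>s. I s"
  proof -
    have "fst ` E \<noteq> {}" using E unfolding cond_def by auto
    then obtain d where "d \<in> fst ` E" by blast
    then have "I (E, d)" using E by (simp add: I_def)
    then show ?thesis by blast
  qed
  have step: "\<exists>t. I t \<and> R s t" if s: "I s" for s
  proof -
    have sI: "cond (fst s)" "fst s \<subseteq> E" using s by (simp_all add: I_def)
    have "\<exists>G\<subseteq>fst s. cond G \<and> (\<forall>b\<in>{b. weight b < snd s}. \<Phi> b G)"
    proof (rule cond_finite_dense[OF finite_weight_less sI(1)])
      show "\<exists>G\<subseteq>F. cond G \<and> \<Phi> b G" if "cond F" "F \<subseteq> fst s" for b F
        using dense that sI by blast
      show "\<Phi> b G" if "cond F" "\<Phi> b F" "cond G" "G \<subseteq> F" for b F G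
        using inv that subset_almost by blast
    qed
    then obtain G where G: "G \<subseteq> fst s" "cond G" "\<forall>b. weight b < snd s \<longrightarrow> \<Phi> b G" by blast
    then have inf: "infinite (fst ` G)" by (simp add: cond_def)
    \<comment> \<open>Two columns are taken: \<open>d\<close> is the reserved one, \<open>e\<close>
      the next selected one.\<close>
    then obtain d where d: "d \<in> fst ` G" "snd s < d"
      unfolding infinite_nat_iff_unbounded by blast
    from inf obtain e where e: "e \<in> fst ` G" "d < e"
      unfolding infinite_nat_iff_unbounded by blast
    have "I (G, e) \<and> R s (G, e)"
      using G d e sI unfolding I_def R_def by auto
    then show ?thesis by blast
  qed
  obtain S where S: "\<And>n. I (S n)" "\<And>n. R (S n) (S (Suc n))"
    using dependent_nat_choice[of "\<lambda>_. I" "\<lambda>_. R"] start step by metis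
  define F where "F n = fst (S n)" for n
  define d where "d n = snd (S n)" for n
  have F: "cond (F n)" "F n \<subseteq> E" "d n \<in> fst ` F n" for n
    using S(1)[of n] by (simp_all add: I_def F_def d_def)
  have FS: "F (Suc n) \<subseteq> F n" "\<And>b. weight b < d n \<Longrightarrow> \<Phi> b (F (Suc n))"
    "\<exists>e\<in>fst ` F (Suc n). d n < e \<and> e < d (Suc n)" for n
    using S(2)[of n] by (simp_all add: R_def F_def d_def)
  have F_anti: "F n \<subseteq> F m" if "m \<le> n" for m n
    using lift_Suc_antimono_le[of F m n] FS(1) that by blast
  have d_mono: "strict_mono d"
    using FS(3) by (intro strict_mono_Suc_iff[THEN iffD2]) (metis less_trans)
  define G where "G = {y. \<exists>n. fst y = d n \<and> y \<in> F n}"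
  have fG: "fst ` G = range d"
  proof
    show "fst ` G \<subseteq> range d" by (auto simp: G_def)
    show "range d \<subseteq> fst ` G"
    proof
      fix c assume "c \<in> range d"
      then obtain n where n: "c = d n" by blast
      then obtain x where "(c, x) \<in> F n" using F(3)[of n] by auto
      then have "(c, x) \<in> G" using n by (auto simp: G_def)
      then show "c \<in> fst ` G" by force
    qed
  qed
  have colG: "G `` {d n} = F n `` {d n}" for n
    using strict_mono_eq[OF d_mono] by (auto simp: G_def)
  have GE: "G \<subseteq> E" using F(2) by (auto simp: G_def)
  have "infinite (range d)" using d_mono by (simp add: strict_mono_imp_inj_on finite_image_iff)
  then have condG: "cond G"
  proof -
    have "F n `` {d n} \<in> P" for n using F(1,3)[of n] unfolding cond_def by blast
    then show ?thesis unfolding cond_def fG using colG \<open>infinite (range d)\<close> by auto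
  qed
  have "\<Phi> b G" for b
  proof -
    define i where "i = (LEAST i. weight b < d i)"
    have "weight b < d (Suc (weight b))"
      using strict_mono_imp_increasing[OF d_mono, of "Suc (weight b)"] by linarith
    then have i: "weight b < d i" unfolding i_def by (rule LeastI)
    have i_least: "i \<le> j" if "weight b < d j" for j
      using that unfolding i_def by (rule Least_le)
    have tail: "y \<in> F (Suc i)" if yG: "y \<in> G" "d i < fst y" for y
    proof -
      obtain l where l: "fst y = d l" "y \<in> F l" using yG(1) unfolding G_def by blast
      then have "Suc i \<le> l" using yG(2) strict_mono_less[OF d_mono] by auto
      then show ?thesis using F_anti l by blast
    qed
    have "nbhd b G \<subseteq> nbhd b (F (Suc i))"
    proof
      fix z assume z: "z \<in> nbhd b G"
      have "z k \<in> F (Suc i) \<and> (\<exists>e\<in>fst ` F (Suc i). weight (pre z k) < e \<and> e < fst (z k))"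
        if k: "length b \<le> k" for k
      proof -
        obtain j where zk: "z k \<in> G" and j: "weight (pre z k) < d j" "d j < fst (z k)"
          using z k fG unfolding nbhd_def by auto
        have "weight b \<le> weight (pre z k)"
          using weight_pre_mono[OF k, of z] nbhd_pre_length[OF z] by simp
        then have ij: "i \<le> j" using j i_least by auto
        then have "d i \<le> d j" using strict_mono_less_eq[OF d_mono] by blast
        then have mem: "z k \<in> F (Suc i)" using tail[OF zk] j by simp
        show ?thesis
        proof (cases "i = j")
          case False
          then have "F j \<subseteq> F (Suc i)" using ij F_anti by auto
          then have "d j \<in> fst ` F (Suc i)" using F(3)[of j] by blast
          then show ?thesis using mem j by blast
        next
          \<comment> \<open>Column \<open>d i\<close> need not survive in \<open>F (Suc i)\<close>,
            so the reserved column \<open>e\<close> separates instead.\<close>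
          case True
          obtain l where l: "fst (z k) = d l" using zk by (auto simp: G_def)
          then have "Suc i \<le> l" using j True strict_mono_less[OF d_mono] by auto
          then have "d (Suc i) \<le> fst (z k)" using l strict_mono_less_eq[OF d_mono] by auto
          moreover obtain e where "e \<in> fst ` F (Suc i)" "d i < e" "e < d (Suc i)"
            using FS(3)[of i] by blast
          ultimately show ?thesis using mem j True
            by (intro conjI bexI[of _ e]) auto
        qed
      qed
      then show "z \<in> nbhd b (F (Suc i))"
        using nbhd_pre_length[OF z] unfolding nbhd_def by blast
    qed
    then have "almost b G (F (Suc i))" unfolding almost_def using tail by blast
    then show "\<Phi> b G" using inv[OF F(1) FS(2)[OF i] condG] by blast
  qed
  then show ?thesis using GE condG by blast
qed

text \<open>Each stem is charged only with the indices up to its length, which leaves finitely many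
  requirements per stem. Applications lose nothing, since a stem can be lengthened along any
  sequence in its neighbourhood.\<close>

lemma fusion_indexed:
  assumes E: "cond E"
    and dense: "\<And>n b F. cond F \<Longrightarrow> F \<subseteq> E \<Longrightarrow> \<exists>G\<subseteq>F. cond G \<and> \<Phi> n b G"
    and inv: "\<And>n b F G. cond F \<Longrightarrow> \<Phi> n b F \<Longrightarrow> cond G \<Longrightarrow> almost b G F \<Longrightarrow> \<Phi> n b G"
  shows "\<exists>G\<subseteq>E. cond G \<and> (\<forall>b. \<forall>n\<le>length b. \<Phi> n b G)"
proof (rule fusion[OF E])
  show "\<exists>G\<subseteq>F. cond G \<and> (\<forall>n\<le>length b. \<Phi> n b G)" if F: "cond F" "F \<subseteq> E" for b F
  proof -
    have "\<exists>G\<subseteq>F. cond G \<and> (\<forall>n\<in>{..length b}. \<Phi> n b G)"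
    proof (rule cond_finite_dense[OF _ F(1)])
      show "\<exists>G\<subseteq>F'. cond G \<and> \<Phi> n b G" if "cond F'" "F' \<subseteq> F" for n F'
        using dense[OF that(1)] that F by blast
      show "\<Phi> n b G'" if "cond F'" "\<Phi> n b F'" "cond G'" "G' \<subseteq> F'" for n F' G'
        using inv that subset_almost by blast
    qed simp
    then show ?thesis by blast
  qed
  show "\<forall>n\<le>length b. \<Phi> n b G"
    if "cond F" "\<forall>n\<le>length b. \<Phi> n b F" "cond G" "almost b G F" for b F G
    using inv that by blast
qed

section \<open>Accepted and rejected stems, in the manner of Galvin and Prikry\<close>

definition decides :: "(nat \<Rightarrow> nat \<times> 'a) set \<Rightarrow> (nat \<times> 'a) list \<Rightarrow> (nat \<times> 'a) set \<Rightarrow> bool" where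
  "decides Y b G \<longleftrightarrow> nbhd b G \<subseteq> Y \<or> (\<forall>F\<subseteq>G. cond F \<longrightarrow> \<not> nbhd b F \<subseteq> Y)"

lemma decides_dense: "cond F \<Longrightarrow> \<exists>G\<subseteq>F. cond G \<and> decides Y b G"
  unfolding decides_def by blast

text \<open>Acceptance passes on by inclusion of neighbourhoods. For rejection, any condition inside
  \<open>G\<close> has a tail inside \<open>F\<close>, and the tail accepts whatever the condition
  accepts.\<close>

lemma decides_almost:
  assumes "cond F" "decides Y b F" "cond G" and al: "almost b G F"
  shows "decides Y b G"
proof (cases "nbhd b F \<subseteq> Y")
  case True
  then show ?thesis using al unfolding decides_def almost_def by blast
next
  case False
  then have rej: "\<And>H. H \<subseteq> F \<Longrightarrow> cond H \<Longrightarrow> \<not> nbhd b H \<subseteq> Y"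
    using assms(2) unfolding decides_def by blast
  obtain n where n: "{y\<in>G. n < fst y} \<subseteq> F" using al unfolding almost_def by blast
  have "\<not> nbhd b H \<subseteq> Y" if H: "H \<subseteq> G" "cond H" for H
  proof
    assume "nbhd b H \<subseteq> Y"
    moreover have "nbhd b {y\<in>H. n < fst y} \<subseteq> nbhd b H" by (intro nbhd_mono) blast
    moreover have "{y\<in>H. n < fst y} \<subseteq> F" using n H by blast
    ultimately show False using rej[OF _ cond_tail[OF H(2)], of n] by blast
  qed
  then show ?thesis unfolding decides_def by blast
qed

text \<open>A first fusion decides every stem. In a second one the next entries are split by whether
  they turn a rejected stem into an accepted one; if all of them did, the stem itself would be
  accepted. So rejection propagates to all longer stems.\<close>

lemma dichotomy:
  assumes E: "cond E"
  shows "\<exists>G\<subseteq>E. cond G \<and> (nbhd a G \<subseteq> Y \<or>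
    (\<forall>z\<in>nbhd a G. \<forall>k\<ge>length a. \<forall>F\<subseteq>G. cond F \<longrightarrow> \<not> nbhd (pre z k) F \<subseteq> Y))"
proof -
  have "\<exists>E1\<subseteq>E. cond E1 \<and> (\<forall>b. decides Y b E1)"
    by (rule fusion[OF E decides_dense decides_almost])
  then obtain E1 where E1: "E1 \<subseteq> E" "cond E1" and dec: "\<And>b. decides Y b E1" by blast
  define rej where "rej b \<longleftrightarrow> (\<forall>F\<subseteq>E1. cond F \<longrightarrow> \<not> nbhd b F \<subseteq> Y)" for b
  have "\<exists>G\<subseteq>E1. cond G \<and> (\<forall>b. rej b \<longrightarrow> (\<forall>z\<in>nbhd b G. rej (b @ [z (length b)])))"
  proof (rule fusion[OF E1(2)])
    fix b F assume F: "cond F" "F \<subseteq> E1"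
    show "\<exists>G\<subseteq>F. cond G \<and> (rej b \<longrightarrow> (\<forall>z\<in>nbhd b G. rej (b @ [z (length b)])))"
    proof (cases "rej b")
      case True
      define C where "C = {x. nbhd (b @ [x]) E1 \<subseteq> Y}"
      obtain G where G: "G \<subseteq> F" "cond G" "G \<subseteq> C \<or> G \<inter> C = {}"
        using cond_split[OF F(1)] by blast
      have nx: "z (length b) \<in> G \<and> z \<in> nbhd (b @ [z (length b)]) E1" if z: "z \<in> nbhd b G" for z
      proof -
        have "pre z (Suc (length b)) = b @ [z (length b)]" using nbhd_pre_length[OF z] by simp
        then have "z \<in> nbhd (b @ [z (length b)]) G"
          using pre_mem_nbhd[OF z, of "Suc (length b)"] by simp
        moreover have "G \<subseteq> E1" using G F by blast
        ultimately show ?thesis using nbhd_mem[OF z] nbhd_mono[of G E1] by blast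
      qed
      have "\<not> G \<subseteq> C"
      proof
        assume "G \<subseteq> C"
        then have "nbhd b G \<subseteq> Y" using nx unfolding C_def by blast
        then show False using True G F unfolding rej_def by blast
      qed
      then have "G \<inter> C = {}" using G by blast
      then have "rej (b @ [z (length b)])" if "z \<in> nbhd b G" for z
        using nx[OF that] dec[of "b @ [z (length b)]"] unfolding C_def decides_def rej_def by blast
      then show ?thesis using G by blast
    qed (use F in blast)
  next
    fix b F G
    assume "cond F" "rej b \<longrightarrow> (\<forall>z\<in>nbhd b F. rej (b @ [z (length b)]))" "almost b G F"
    then show "rej b \<longrightarrow> (\<forall>z\<in>nbhd b G. rej (b @ [z (length b)]))"
      unfolding almost_def by blast
  qed
  then obtain G where G: "G \<subseteq> E1" "cond G"
    and nxt: "\<And>b z. rej b \<Longrightarrow> z \<in> nbhd b G \<Longrightarrow> rej (b @ [z (length b)])" by blast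
  show ?thesis
  proof (cases "rej a")
    case True
    have rejs: "rej (pre z k)" if z: "z \<in> nbhd a G" and k: "length a \<le> k" for z k
      using k
    proof (induction k rule: dec_induct)
      case base
      then show ?case using True nbhd_pre_length[OF z] by simp
    next
      case (step k)
      then show ?case using nxt[of "pre z k" z] pre_mem_nbhd[OF z, of k] by simp
    qed
    have "\<forall>z\<in>nbhd a G. \<forall>k\<ge>length a. \<forall>F\<subseteq>G. cond F \<longrightarrow> \<not> nbhd (pre z k) F \<subseteq> Y"
    proof (intro ballI allI impI)
      fix z k F assume "z \<in> nbhd a G" "length a \<le> k" "F \<subseteq> G" "cond F"
      then show "\<not> nbhd (pre z k) F \<subseteq> Y"
        using rejs[of z k] subset_trans[OF _ G(1), of F] unfolding rej_def by blast
    qed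
    then show ?thesis using subset_trans[OF G(1) E1(1)] G(2) by blast
  next
    case False
    then have "nbhd a E1 \<subseteq> Y" using dec[of a] unfolding decides_def rej_def by blast
    then show ?thesis using E1 by blast
  qed
qed

text \<open>CR: completely Ramsey.\<close>
definition CR :: "(nat \<Rightarrow> nat \<times> 'a) set \<Rightarrow> bool" where
  "CR X \<longleftrightarrow> (\<forall>a E. cond E \<longrightarrow> (\<exists>G\<subseteq>E. cond G \<and> (nbhd a G \<subseteq> X \<or> nbhd a G \<inter> X = {})))"

section \<open>Closure properties of completely Ramsey sets\<close>

lemma CR_E:
  assumes "CR X" "cond E"
  obtains G where "G \<subseteq> E" "cond G" "nbhd a G \<subseteq> X \<or> nbhd a G \<inter> X = {}"
  using assms unfolding CR_def by metis

text \<open>In the rejecting alternative of \<open>dichotomy\<close>, a point of \<open>X\<close>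
  would have an initial segment that is accepted.\<close>

lemma CR_I_relatively_open:
  assumes "\<And>a E. cond E \<Longrightarrow> \<exists>F\<subseteq>E. cond F \<and>
    (\<forall>z\<in>nbhd a F \<inter> X. \<exists>k\<ge>length a. nbhd (pre z k) F \<subseteq> X)"
  shows "CR X"
  unfolding CR_def
proof (intro allI impI)
  fix a :: "(nat \<times> 'a) list" and E assume "cond E"
  then obtain F where F: "F \<subseteq> E" "cond F"
    "\<And>z. z \<in> nbhd a F \<Longrightarrow> z \<in> X \<Longrightarrow> \<exists>k\<ge>length a. nbhd (pre z k) F \<subseteq> X"
    using assms[of E a] by blast
  obtain G where G: "G \<subseteq> F" "cond G" "nbhd a G \<subseteq> X \<or>
    (\<forall>z\<in>nbhd a G. \<forall>k\<ge>length a. \<forall>H\<subseteq>G. cond H \<longrightarrow> \<not> nbhd (pre z k) H \<subseteq> X)"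
    using dichotomy[OF F(2), of a X] by blast
  have "nbhd a G \<inter> X = {}" if n: "\<not> nbhd a G \<subseteq> X"
  proof -
    have False if z: "z \<in> nbhd a G" "z \<in> X" for z
    proof -
      obtain k where k: "k \<ge> length a" "nbhd (pre z k) F \<subseteq> X"
        using F(3)[of z] z nbhd_mono[OF G(1)] by blast
      then have "nbhd (pre z k) G \<subseteq> X" using nbhd_mono[OF G(1)] by blast
      then show False using G n z k by blast
    qed
    then show ?thesis by blast
  qed
  then show "\<exists>G\<subseteq>E. cond G \<and> (nbhd a G \<subseteq> X \<or> nbhd a G \<inter> X = {})"
    using subset_trans[OF G(1) F(1)] G(2) by blast
qed

lemma CR_open:
  assumes "\<And>z. z \<in> X \<Longrightarrow> \<exists>k. \<forall>y. pre y k = pre z k \<longrightarrow> y \<in> X"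
  shows "CR X"
proof (rule CR_I_relatively_open)
  fix a :: "(nat \<times> 'a) list" and E assume E: "cond E"
  have "\<exists>k\<ge>length a. nbhd (pre z k) E \<subseteq> X" if z: "z \<in> X" for z
  proof -
    obtain k where k: "\<And>y. pre y k = pre z k \<Longrightarrow> y \<in> X" using assms[OF z] by blast
    have "y \<in> X" if "y \<in> nbhd (pre z (max k (length a))) E" for y
      using nbhd_pre_length[OF that] by (intro k) (simp add: pre_eq_iff)
    then show ?thesis by (intro exI[of _ "max k (length a)"]) auto
  qed
  then show "\<exists>F\<subseteq>E. cond F \<and> (\<forall>z\<in>nbhd a F \<inter> X. \<exists>k\<ge>length a. nbhd (pre z k) F \<subseteq> X)"
    using E by blast
qed

lemma CR_Compl: "CR X \<Longrightarrow> CR (- X)"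
  unfolding CR_def by (metis Compl_disjoint disjoint_eq_subset_Compl double_compl inf.commute)

text \<open>A single condition settles \<open>X n\<close> at all stems of length at least
  \<open>n\<close>. Inside it each point of the union has a whole neighbourhood in some
  \<open>X n\<close>, so the union is relatively open there.\<close>

lemma CR_UN:
  assumes "\<And>n::nat. CR (X n)"
  shows "CR (\<Union>n. X n)"
proof (rule CR_I_relatively_open)
  fix a :: "(nat \<times> 'a) list" and E assume E: "cond E"
  have "\<exists>G\<subseteq>E. cond G \<and> (\<forall>b. \<forall>n\<le>length b. nbhd b G \<subseteq> X n \<or> nbhd b G \<inter> X n = {})"
  proof (rule fusion_indexed[OF E])
    show "\<exists>G\<subseteq>F. cond G \<and> (nbhd b G \<subseteq> X n \<or> nbhd b G \<inter> X n = {})" if "cond F" for n b F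
      using CR_E[OF assms that] by metis
  qed (unfold almost_def, blast)
  then obtain G where G: "G \<subseteq> E" "cond G"
    and dec: "\<And>b n. n \<le> length b \<Longrightarrow> nbhd b G \<subseteq> X n \<or> nbhd b G \<inter> X n = {}" by blast
  have "\<exists>k\<ge>length a. nbhd (pre z k) G \<subseteq> (\<Union>n. X n)" if z: "z \<in> nbhd a G" "z \<in> X n" for z n
  proof -
    have "z \<in> nbhd (pre z (max n (length a))) G" using pre_mem_nbhd[OF z(1)] by simp
    then have "nbhd (pre z (max n (length a))) G \<subseteq> X n"
      using dec[of n "pre z (max n (length a))"] z by auto
    then show ?thesis by (intro exI[of _ "max n (length a)"]) auto
  qed
  then show "\<exists>F\<subseteq>E. cond F \<and> (\<forall>z\<in>nbhd a F \<inter> (\<Union>n. X n).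
      \<exists>k\<ge>length a. nbhd (pre z k) F \<subseteq> (\<Union>n. X n))"
    using G by blast
qed

lemma CR_INT:
  assumes "\<And>n::nat. CR (X n)"
  shows "CR (\<Inter>n. X n)"
proof -
  have "CR (- (\<Union>n. - X n))" using assms by (intro CR_Compl CR_UN)
  then show ?thesis by simp
qed

lemma CR_Un: "CR X \<Longrightarrow> CR Y \<Longrightarrow> CR (X \<union> Y)"
proof -
  assume "CR X" "CR Y"
  then have "CR (\<Union>n::nat. if n = 0 then X else Y)" by (intro CR_UN) simp
  moreover have "(\<Union>n::nat. if n = 0 then X else Y) = X \<union> Y" by (auto split: if_splits)
  ultimately show ?thesis by simp
qed

lemma CR_Int:
  assumes "CR X" "CR Y" shows "CR (X \<inter> Y)"
proof -
  have "CR (- (- X \<union> - Y))" by (intro CR_Compl CR_Un assms)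
  then show ?thesis by simp
qed

text \<open>
  Each section X s of the scheme has a relatively closed hull K s which X s meets in every
  neighbourhood. So the sets N s, where the hulls of the successors fail to cover the hull of s, are
  negligible, and off their union the Souslin set coincides with the hull of its root.
\<close>
lemma CR_Souslin:
  assumes A: "\<And>s::nat list. CR (A s)"
  shows "CR (\<Union>\<sigma>::nat \<Rightarrow> nat. \<Inter>n. A (pre \<sigma> (Suc n)))"
  unfolding CR_def
proof (intro allI impI)
  fix a :: "(nat \<times> 'a) list" and E assume E: "cond E"
  \<comment> \<open>The witnessing branch has to satisfy all conditions of the scheme, also those
    before the node \<open>s\<close>.\<close>
  define X where "X s = {z. \<exists>\<sigma>. pre \<sigma> (length s) = s \<and> (\<forall>n. z \<in> A (pre \<sigma> (Suc n)))}"
    for s :: "nat list"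
  have X_Nil: "X [] = (\<Union>\<sigma>. \<Inter>n. A (pre \<sigma> (Suc n)))"
    unfolding X_def by auto
  have X_split: "\<exists>n. z \<in> X (s @ [n])" if "z \<in> X s" for z s
  proof -
    obtain \<sigma> where \<sigma>: "pre \<sigma> (length s) = s" "\<forall>n. z \<in> A (pre \<sigma> (Suc n))"
      using \<open>z \<in> X s\<close> unfolding X_def by blast
    then have "z \<in> X (s @ [\<sigma> (length s)])"
      unfolding X_def by (auto intro!: exI[of _ \<sigma>])
    then show ?thesis by blast
  qed
  have X_P: "z \<in> A s" if z: "z \<in> X s" and "s \<noteq> []" for z s
  proof -
    obtain \<sigma> where \<sigma>: "pre \<sigma> (length s) = s" "\<And>n. z \<in> A (pre \<sigma> (Suc n))"
      using z unfolding X_def by blast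
    obtain m where "length s = Suc m" using \<open>s \<noteq> []\<close> by (cases s) auto
    then show ?thesis using \<sigma>(1) \<sigma>(2)[of m] by simp
  qed
  \<comment> \<open>Stems of length at least \<open>to_nat s\<close> get decided for the complement
    of \<open>X s\<close>: if such a neighbourhood meets \<open>X s\<close>, it still does so in
    every smaller condition.\<close>
  have "\<exists>G\<subseteq>E. cond G \<and> (\<forall>b. \<forall>n\<le>length b. decides (- X (from_nat n)) b G)"
    by (rule fusion_indexed[OF E decides_dense decides_almost])
  then obtain E1 where E1: "E1 \<subseteq> E" "cond E1"
    and dec: "\<And>b n. n \<le> length b \<Longrightarrow> decides (- X (from_nat n)) b E1" by blast
  have meets: "nbhd b F \<inter> X s \<noteq> {}"
    if "to_nat s \<le> length b" "nbhd b E1 \<inter> X s \<noteq> {}" "F \<subseteq> E1" "cond F" for b s F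
  proof -
    have "decides (- X s) b E1" using dec[OF that(1)] by simp
    moreover have "\<not> nbhd b E1 \<subseteq> - X s" using that(2) by blast
    ultimately have "\<not> nbhd b F \<subseteq> - X s" using that(3,4) unfolding decides_def by blast
    then show ?thesis by blast
  qed
  \<comment> \<open>From length \<open>j s\<close> on, an initial segment covers the stem
    \<open>a\<close> and is long enough for \<open>meets\<close> to apply.\<close>
  define j where "j s = max (length a) (to_nat s)" for s :: "nat list"
  define K where "K s = {z. \<forall>k\<ge>j s. nbhd (pre z k) E1 \<inter> X s \<noteq> {}}" for s
  have CR_K: "CR (K s)" for s
  proof -
    have "CR (- K s)"
    proof (rule CR_open)
      fix z assume "z \<in> - K s"
      then obtain k where k: "k \<ge> j s" "nbhd (pre z k) E1 \<inter> X s = {}" unfolding K_def by blast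
      have "y \<in> - K s" if "pre y k = pre z k" for y
        using k unfolding K_def that[symmetric] by blast
      then show "\<exists>k. \<forall>y. pre y k = pre z k \<longrightarrow> y \<in> - K s" by blast
    qed
    then show ?thesis using CR_Compl by fastforce
  qed
  \<comment> \<open>The scheme imposes conditions from length one on, so \<open>A []\<close> is left
    out at the root.\<close>
  define H where "H s = K s \<inter> (if s = [] then UNIV else A s)" for s
  have CR_UNIV: "CR UNIV" by (rule CR_open) simp
  have CR_H: "CR (H s)" for s unfolding H_def using CR_K A CR_UNIV by (simp add: CR_Int)
  have XK: "z \<in> K s" if "z \<in> nbhd a E1" "z \<in> X s" for z s
  proof -
    have "z \<in> nbhd (pre z k) E1" if "j s \<le> k" for k
      using pre_mem_nbhd[OF \<open>z \<in> nbhd a E1\<close>] that by (simp add: j_def)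
    then show ?thesis using that(2) unfolding K_def by blast
  qed
  have XH: "z \<in> H s" if "z \<in> nbhd a E1" "z \<in> X s" for z s
    using XK[OF that] X_P[OF that(2)] unfolding H_def by auto
  define N where "N s = H s - (\<Union>n. H (s @ [n]))" for s
  have CR_N: "CR (N s)" for s
    unfolding N_def Diff_eq by (intro CR_Int CR_Compl CR_UN CR_H)
  \<comment> \<open>For stems that continue \<open>a\<close> inside \<open>E1\<close>, the
    neighbourhood of \<open>b\<close> lies within that of \<open>a\<close>, where \<open>XH\<close>
    applies.\<close>
  define tree where "tree b \<longleftrightarrow> (\<exists>y\<in>nbhd a E1. \<exists>k\<ge>length a. b = pre y k)" for b
  have N_null: "\<exists>G\<subseteq>F. cond G \<and> nbhd b G \<inter> N s = {}"
    if F: "cond F" "F \<subseteq> E1" and b: "tree b" for b F s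
  proof -
    obtain G where G: "G \<subseteq> F" "cond G" "nbhd b G \<subseteq> N s \<or> nbhd b G \<inter> N s = {}"
      using CR_E[OF CR_N F(1)] by metis
    have "\<not> nbhd b G \<subseteq> N s"
    proof
      \<comment> \<open>A point \<open>z\<close> of \<open>N s\<close> lies in the hull of
        \<open>s\<close>, so the same neighbourhood contains some \<open>v\<close> in
        \<open>X s\<close>. That \<open>v\<close> lies in the section of a successor and hence in
        its hull, contrary to \<open>v\<close> being in \<open>N s\<close>.\<close>
      assume sub: "nbhd b G \<subseteq> N s"
      obtain z where z: "z \<in> nbhd b G" using nbhd_nonempty[OF G(2)] by blast
      obtain y k where "y \<in> nbhd a E1" "length a \<le> k" "b = pre y k"
        using b unfolding tree_def by blast
      then have lb: "length a \<le> length b" and "nbhd b E1 \<subseteq> nbhd a E1"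
        using nbhd_pre_subset by auto
      moreover have "nbhd b G \<subseteq> nbhd b E1" using G F by (intro nbhd_mono) blast
      ultimately have sub': "nbhd b G \<subseteq> nbhd a E1" by blast
      define k where "k = max (length b) (to_nat s)"
      have k: "length b \<le> k" "j s \<le> k" "to_nat s \<le> k" using lb by (auto simp: k_def j_def)
      have "nbhd (pre z k) E1 \<inter> X s \<noteq> {}"
        using sub z k unfolding N_def H_def K_def by blast
      then obtain v where v: "v \<in> nbhd (pre z k) G" "v \<in> X s"
        using meets[of s "pre z k" G] k G F by auto
      then have "v \<in> nbhd b G" using nbhd_pre_subset[OF z k(1)] by blast
      moreover obtain n where "v \<in> X (s @ [n])" using X_split v by blast
      ultimately show False using XH[of v "s @ [n]"] sub sub' unfolding N_def by blast
    qed
    then show ?thesis using G by blast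
  qed
  have "\<exists>G\<subseteq>E1. cond G \<and> (\<forall>b. \<forall>n\<le>length b. tree b \<longrightarrow> nbhd b G \<inter> N (from_nat n) = {})"
  proof (rule fusion_indexed[OF E1(2)])
    show "\<exists>G\<subseteq>F. cond G \<and> (tree b \<longrightarrow> nbhd b G \<inter> N (from_nat n) = {})"
      if F: "cond F" "F \<subseteq> E1" for n b F
    proof (cases "tree b")
      case True
      then show ?thesis using N_null[OF F True, of "from_nat n"] by simp
    qed (use F(1) in auto)
  qed (unfold almost_def, blast)
  then obtain G where G: "G \<subseteq> E1" "cond G"
    and GN: "\<And>b n. n \<le> length b \<Longrightarrow> tree b \<Longrightarrow> nbhd b G \<inter> N (from_nat n) = {}" by blast
  have noN: "z \<notin> N s" if z: "z \<in> nbhd a G" for z s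
  proof -
    have "z \<in> nbhd a E1" using z nbhd_mono[OF G(1)] by blast
    moreover have "length a \<le> j s" by (simp add: j_def)
    ultimately have "tree (pre z (j s))" unfolding tree_def by blast
    moreover have "z \<in> nbhd (pre z (j s)) G" using pre_mem_nbhd[OF z] by (simp add: j_def)
    ultimately show ?thesis using GN[of "to_nat s" "pre z (j s)"] by (auto simp: j_def)
  qed
  obtain G' where G': "G' \<subseteq> G" "cond G'" "nbhd a G' \<subseteq> K [] \<or> nbhd a G' \<inter> K [] = {}"
    using CR_E[OF CR_K G(2)] by metis
  have in_G: "z \<in> nbhd a G" "z \<in> nbhd a E1" if "z \<in> nbhd a G'" for z
    using that nbhd_mono G(1) G'(1) by blast+
  have KX: "z \<in> X []" if z: "z \<in> nbhd a G'" "z \<in> K []" for z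
  proof -
    \<comment> \<open>Outside all the sets \<open>N s\<close>, membership in \<open>H s\<close>
      passes on to a successor; climbing from the root yields a branch.\<close>
    have "\<exists>S. \<forall>n. (z \<in> H (S n) \<and> length (S n) = n) \<and> (\<exists>m. S (Suc n) = S n @ [m])"
    proof (rule dependent_nat_choice)
      show "\<exists>s. z \<in> H s \<and> length s = 0" using z by (auto simp: H_def)
      fix s n assume s: "z \<in> H s \<and> length s = n"
      then obtain m where "z \<in> H (s @ [m])"
        using noN[OF in_G(1)[OF z(1)], of s] unfolding N_def by blast
      then show "\<exists>t. (z \<in> H t \<and> length t = Suc n) \<and> (\<exists>m. t = s @ [m])"
        using s by (intro exI[of _ "s @ [m]"]) auto
    qed
    then obtain S where S: "\<And>n. z \<in> H (S n)" "\<And>n. length (S n) = n"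
      "\<And>n. \<exists>m. S (Suc n) = S n @ [m]" by blast
    define \<sigma> where "\<sigma> n = last (S (Suc n))" for n
    have S\<sigma>: "pre \<sigma> n = S n" for n
    proof (induction n)
      case 0
      then show ?case using S(2)[of 0] by simp
    next
      case (Suc n)
      then show ?case using S(3)[of n] by (auto simp: \<sigma>_def)
    qed
    have "z \<in> A (pre \<sigma> (Suc n))" for n
      using S(1,2)[of "Suc n"] unfolding S\<sigma> H_def by (auto split: if_splits)
    then show ?thesis unfolding X_def by auto
  qed
  have "nbhd a G' \<subseteq> X [] \<or> nbhd a G' \<inter> X [] = {}"
    using G'(3) KX XK in_G by blast
  then show "\<exists>G\<subseteq>E. cond G \<and> (nbhd a G \<subseteq> (\<Union>\<sigma>. \<Inter>n. A (pre \<sigma> (Suc n))) \<or>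
      nbhd a G \<inter> (\<Union>\<sigma>. \<Inter>n. A (pre \<sigma> (Suc n))) = {})"
    unfolding X_Nil[symmetric] using G' G E1 by blast
qed

text \<open>Induction over the generation of \<open>Cmeasurable\<close>. The map to value sets need
  not be continuous: hitting a number is an open condition, missing it a closed one. So cylinders
  pull back to Boolean combinations of open sets.\<close>

lemma CR_vimage_Cmeasurable:
  fixes v :: "nat \<times> 'a \<Rightarrow> nat"
  assumes "A \<in> Cmeasurable"
  shows "CR {z. v ` range z \<in> A}"
proof -
  have hit: "CR {z. m \<in> v ` range z}" for m
  proof (rule CR_open)
    fix z :: "nat \<Rightarrow> nat \<times> 'a" assume "z \<in> {z. m \<in> v ` range z}"
    then obtain i where i: "m = v (z i)" by blast
    have "m \<in> v ` range y" if "pre y (Suc i) = pre z (Suc i)" for y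
    proof -
      have "m = v (y i)" using that i by simp
      then show ?thesis by blast
    qed
    then show "\<exists>k. \<forall>y. pre y k = pre z k \<longrightarrow> y \<in> {z. m \<in> v ` range z}" by blast
  qed
  \<comment> \<open>Infinity of the value set becomes a countable intersection of countable unions
    of open conditions.\<close>
  have unbounded: "(\<forall>n. \<exists>k. n + k \<in> S) \<longleftrightarrow> S \<in> Pinf" for S
    unfolding Pinf_def mem_Collect_eq infinite_nat_iff_unbounded_le le_iff_add by blast
  have "CR (\<Inter>n::nat. \<Union>k::nat. {z. n + k \<in> v ` range z})"
    by (intro CR_INT CR_UN hit)
  moreover have "(\<Inter>n::nat. \<Union>k::nat. {z :: nat \<Rightarrow> nat \<times> 'a. n + k \<in> v ` range z}) = {z. v ` range z \<in> Pinf}"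
    unfolding unbounded[symmetric] by blast
  ultimately have inf: "CR {z. v ` range z \<in> Pinf}" by simp
  have agree: "CR {z. v ` range z \<inter> {..<n} = F \<inter> {..<n}}" for n F
  proof (induction n)
    case 0
    show ?case by (rule CR_open) simp
  next
    case (Suc n)
    have "{z :: nat \<Rightarrow> nat \<times> 'a. v ` range z \<inter> {..<Suc n} = F \<inter> {..<Suc n}} =
      {z. v ` range z \<inter> {..<n} = F \<inter> {..<n}} \<inter>
      (if n \<in> F then {z. n \<in> v ` range z} else - {z. n \<in> v ` range z})"
      by (auto simp: lessThan_Suc)
    then show ?case using Suc hit by (auto intro!: CR_Int CR_Compl)
  qed
  from assms show ?thesis
  proof (induction rule: Cmeasurable.induct)
    case (open_set V)
    \<comment> \<open>The index codes a bound and a finite set; those whose cylinder lies in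
      \<open>V\<close> are kept, the others contribute the empty set.\<close>
    define B where "B i = (case from_nat i of (n, l) \<Rightarrow>
      if \<forall>T. T \<inter> {..<n} = set l \<inter> {..<n} \<longrightarrow> T \<in> V
      then {z :: nat \<Rightarrow> nat \<times> 'a. v ` range z \<inter> {..<n} = set l \<inter> {..<n}} else {})" for i
    have "CR {}" using CR_open[of "{}"] by simp
    then have "CR (\<Union>i. B i)"
      unfolding B_def using agree by (intro CR_UN) (simp split: prod.split)
    moreover have "(\<Union>i. B i) = {z :: nat \<Rightarrow> nat \<times> 'a. v ` range z \<in> V}"
    proof
      show "(\<Union>i. B i) \<subseteq> {z. v ` range z \<in> V}"
        unfolding B_def by (auto split: prod.splits if_splits)
      show "{z. v ` range z \<in> V} \<subseteq> (\<Union>i. B i)"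
      proof
        fix z :: "nat \<Rightarrow> nat \<times> 'a" assume "z \<in> {z. v ` range z \<in> V}"
        then obtain n where n: "\<And>T. T \<inter> {..<n} = v ` range z \<inter> {..<n} \<Longrightarrow> T \<in> V"
          using open_set unfolding cantor_open_def by blast
        obtain l where l: "set l = v ` range z \<inter> {..<n}"
          using finite_list[of "v ` range z \<inter> {..<n}"] by auto
        then have "z \<in> B (to_nat (n, l))"
          unfolding B_def using n by simp
        then show "z \<in> (\<Union>i. B i)" by blast
      qed
    qed
    ultimately have "CR ({z. v ` range z \<in> V} \<inter> {z. v ` range z \<in> Pinf})"
      using inf by (intro CR_Int) simp_all
    moreover have "{z :: nat \<Rightarrow> nat \<times> 'a. v ` range z \<in> V} \<inter> {z. v ` range z \<in> Pinf} = {z. v ` range z \<in> V \<inter> Pinf}"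
      by blast
    ultimately show ?case by simp
  next
    case (compl A)
    then have "CR ({z. v ` range z \<in> Pinf} \<inter> - {z. v ` range z \<in> A})"
      by (intro CR_Int CR_Compl inf)
    moreover have "{z :: nat \<Rightarrow> nat \<times> 'a. v ` range z \<in> Pinf} \<inter> - {z. v ` range z \<in> A} = {z. v ` range z \<in> Pinf - A}"
      by blast
    ultimately show ?case by simp
  next
    case (countable_union F)
    then have "CR (\<Union>n. {z. v ` range z \<in> F n})" by (intro CR_UN)
    moreover have "(\<Union>n. {z :: nat \<Rightarrow> nat \<times> 'a. v ` range z \<in> F n}) = {z. v ` range z \<in> (\<Union>n. F n)}" by blast
    ultimately show ?case by simp
  next
    case (souslin S)
    then have "CR (\<Union>\<sigma>. \<Inter>n. {z. v ` range z \<in> S (pre \<sigma> (Suc n))})" by (intro CR_Souslin)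
    moreover have "(\<Union>\<sigma>. \<Inter>n. {z :: nat \<Rightarrow> nat \<times> 'a. v ` range z \<in> S (pre \<sigma> (Suc n))}) =
      {z. v ` range z \<in> (\<Union>\<sigma>. \<Inter>n. S (pre \<sigma> (Suc n)))}" by blast
    ultimately show ?case by simp
  qed
qed

end

section \<open>Positive sets and big sets of points\<close>

definition positive :: "nat set set \<Rightarrow> nat set \<Rightarrow> bool" where
  "positive \<B> S \<longleftrightarrow> (\<exists>B\<in>\<B>. infinite (B \<inter> S))"

lemma positive_mono: "positive \<B> S \<Longrightarrow> S \<subseteq> T \<Longrightarrow> positive \<B> T"
  unfolding positive_def by (meson Int_mono finite_subset order_refl)

lemma positive_Un: "positive \<B> (S \<union> T) \<Longrightarrow> positive \<B> S \<or> positive \<B> T"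
  unfolding positive_def Int_Un_distrib by auto

lemma positive_infinite: "positive \<B> S \<Longrightarrow> infinite S"
  unfolding positive_def by (meson finite_Int)

lemma positive_obtains_subset:
  assumes "hereditary \<B>" "positive \<B> S"
  obtains B where "B \<in> \<B>" "B \<subseteq> S"
proof -
  obtain B where B: "B \<in> \<B>" "infinite (B \<inter> S)" using assms(2) unfolding positive_def by blast
  then have "B \<inter> S \<in> \<B>" using assms(1) unfolding hereditary_def by blast
  then show ?thesis using that by blast
qed

definition points_above :: "nat list \<times> nat \<Rightarrow> (nat list \<times> nat) set \<Rightarrow> (nat list \<times> nat) set" where
  "points_above x p = {y\<in>p. strict_prefix (fst x) (fst y)}"

definition big :: "nat set set \<Rightarrow> (nat list \<times> nat) set \<Rightarrow> bool" where
  "big \<B> p \<longleftrightarrow> p \<noteq> {} \<and> (\<forall>x\<in>p. positive \<B> (snd ` points_above x p))"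

lemma points_above_subset: "points_above x p \<subseteq> p"
  unfolding points_above_def by blast

lemma points_above_points_above: "y \<in> points_above x p \<Longrightarrow> points_above y (points_above x q) = points_above y q"
  unfolding points_above_def using prefix_order.less_trans by blast

lemma big_positive:
  assumes "big \<B> p" shows "positive \<B> (snd ` p)"
proof -
  obtain x where "x \<in> p" "positive \<B> (snd ` points_above x p)" using assms unfolding big_def by blast
  then show ?thesis using positive_mono image_mono[OF points_above_subset] by metis
qed

lemma big_above:
  assumes p: "big \<B> p" and x: "x \<in> p" shows "big \<B> (points_above x p)"
proof -
  have "positive \<B> (snd ` points_above x p)" using p x unfolding big_def by blast
  then have "points_above x p \<noteq> {}" using positive_infinite by fastforce
  moreover have "positive \<B> (snd ` points_above y (points_above x p))" if "y \<in> points_above x p" for y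
    using p that points_above_subset[of x p] unfolding big_def points_above_points_above[OF that] by blast
  ultimately show ?thesis unfolding big_def by blast
qed

text \<open>If the part in \<open>C\<close> is positive above every point of \<open>p\<close>, it is
  big. Otherwise it fails to be so above some \<open>x\<close>, hence above every later point too,
  and the remainder above \<open>x\<close> is big because one half of a positive set is
  positive.\<close>

lemma big_split:
  assumes p: "big \<B> p"
  shows "(\<exists>q. big \<B> q \<and> q \<subseteq> p \<inter> C) \<or> (\<exists>q. big \<B> q \<and> q \<subseteq> p - C)"
proof (cases "\<forall>x\<in>p. positive \<B> (snd ` points_above x (p \<inter> C))")
  case True
  obtain x where "x \<in> p" using p unfolding big_def by blast
  then have "points_above x (p \<inter> C) \<noteq> {}" using True positive_infinite by fastforce
  then have "p \<inter> C \<noteq> {}" unfolding points_above_def by blast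
  then have "big \<B> (p \<inter> C)" using True unfolding big_def by blast
  then show ?thesis by blast
next
  case False
  then obtain x where x: "x \<in> p" "\<not> positive \<B> (snd ` points_above x (p \<inter> C))" by blast
  have pos: "positive \<B> (snd ` points_above y (p - C))" if y: "y = x \<or> y \<in> points_above x p" for y
  proof -
    have "y \<in> p" using y x points_above_subset by blast
    then have "positive \<B> (snd ` points_above y p)" using p unfolding big_def by blast
    moreover have "snd ` points_above y p = snd ` points_above y (p \<inter> C) \<union> snd ` points_above y (p - C)"
      unfolding points_above_def by blast
    moreover have "points_above y (p \<inter> C) \<subseteq> points_above x (p \<inter> C)"
      using y prefix_order.less_trans unfolding points_above_def by blast
    then have "\<not> positive \<B> (snd ` points_above y (p \<inter> C))"
      using x(2) positive_mono image_mono by metis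
    ultimately show ?thesis using positive_Un by metis
  qed
  have "points_above x (p - C) \<noteq> {}" using pos[of x] positive_infinite by fastforce
  moreover have "positive \<B> (snd ` points_above y (points_above x (p - C)))" if y: "y \<in> points_above x (p - C)" for y
    using pos[of y] y unfolding points_above_points_above[OF y] by (auto simp: points_above_def)
  ultimately have "big \<B> (points_above x (p - C))" unfolding big_def by blast
  then show ?thesis using points_above_subset by metis
qed

text \<open>The Ramsey theorem is applied to the sequences whose values form a member of \<B>. The
  M-property produces one such sequence below any condition, so the homogeneous condition consists
  of them; its columns are the \<open>q k\<close>.\<close>

lemma big_fan:
  assumes \<B>: "\<B> \<subseteq> Pinf" "\<B> \<in> Cmeasurable" "M_family \<B>"
    and p: "big \<B> p" and x: "x \<in> p"
  obtains q :: "nat \<Rightarrow> (nat list \<times> nat) set"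
    where "\<And>k. big \<B> (q k)" and "\<And>k. q k \<subseteq> points_above x p"
      and "\<And>S. infinite {k. snd ` q k \<inter> S \<noteq> {}} \<Longrightarrow> positive \<B> S"
proof -
  have her: "hereditary \<B>" using \<B>(3) unfolding M_family_def by blast
  interpret column_ramsey "{p. big \<B> p}"
  proof
    show "p \<noteq> {}" if "p \<in> {p. big \<B> p}" for p using that by (simp add: big_def)
    show "(\<exists>q\<in>{p. big \<B> p}. q \<subseteq> p \<inter> C) \<or> (\<exists>q\<in>{p. big \<B> p}. q \<subseteq> p - C)"
      if "p \<in> {p. big \<B> p}" for p C using that big_split[of \<B> p C] by simp
  qed
  define v where "v y = snd (snd y)" for y :: "nat \<times> nat list \<times> nat"
  \<comment> \<open>Every column starts as a copy of the same big set.\<close>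
  define E where "E = (UNIV :: nat set) \<times> points_above x p"
  have ba: "big \<B> (points_above x p)" by (rule big_above[OF p x])
  then have "fst ` E = UNIV" unfolding E_def big_def by (simp add: fst_image_times)
  then have "cond E" unfolding cond_def using ba by (simp add: E_def Image_def)
  then obtain G where G: "G \<subseteq> E" "cond G"
    "nbhd [] G \<subseteq> {z. v ` range z \<in> \<B>} \<or> nbhd [] G \<inter> {z. v ` range z \<in> \<B>} = {}"
    using CR_E[OF CR_vimage_Cmeasurable[OF \<B>(2), of v]] by metis
  have infG: "infinite (fst ` G)" and bigG: "\<And>n. n \<in> fst ` G \<Longrightarrow> big \<B> (G `` {n})"
    using G(2) unfolding cond_def by blast+
  have "nbhd [] G \<inter> {z. v ` range z \<in> \<B>} \<noteq> {}"
  proof -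
    have "\<exists>d A. d \<in> fst ` G \<and> i < d \<and> A \<in> \<B> \<and> A \<subseteq> snd ` (G `` {d})" for i
    proof -
      obtain d where d: "d \<in> fst ` G" "i < d"
        using infG unfolding infinite_nat_iff_unbounded by blast
      then show ?thesis
        using positive_obtains_subset[OF her big_positive[OF bigG[OF d(1)]]] by metis
    qed
    then obtain d A where dA: "\<And>i. d i \<in> fst ` G" "\<And>i. i < d i" "\<And>i. A i \<in> \<B>"
      "\<And>i. A i \<subseteq> snd ` (G `` {d i})" by metis
    obtain B where B: "B \<in> \<B>" "\<And>n. finite (B - (\<Union>i\<in>{n..}. A i))"
      using \<B>(3) dA(3) unfolding M_family_def by metis
    have infB: "infinite B" using B \<B>(1) unfolding Pinf_def by blast
    \<comment> \<open>Almost all of \<open>B\<close> is covered by the \<open>A i\<close> with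
      \<open>n \<le> i\<close>, which gives points with value in \<open>B\<close> in arbitrarily
      late columns. Increasing values keep the value set infinite, so that heredity applies.\<close>
    have "\<exists>y\<in>G. n < fst y \<and> (v y \<in> B \<and> (\<forall>y'\<in>set c. v y' < v y))" for c n
    proof -
      have "infinite (B \<inter> (\<Union>i\<in>{n..}. A i))"
        using infB B(2)[of n] by (metis Diff_Int_distrib2 Int_Diff Un_Diff_Int finite_UnI inf.idem)
      then have "infinite (B \<inter> (\<Union>i\<in>{n..}. A i) - {..sum_list (map v c)})" by simp
      then obtain m where m: "m \<in> B \<inter> (\<Union>i\<in>{n..}. A i) - {..sum_list (map v c)}"
        using infinite_imp_nonempty by blast
      then obtain i where i: "n \<le> i" "m \<in> A i" by auto
      then obtain w where w: "(d i, w) \<in> G" "m = snd w" using dA(4)[of i] by blast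
      have "v y' \<le> sum_list (map v c)" if "y' \<in> set c" for y'
        using member_le_sum_list[of "v y'" "map v c"] that by simp
      moreover have "sum_list (map v c) < v (d i, w)" using m w by (simp add: v_def)
      ultimately have "\<forall>y'\<in>set c. v y' < v (d i, w)" by (meson le_less_trans)
      moreover have "n < d i" using i dA(2)[of i] by simp
      ultimately show ?thesis using w m by (intro bexI[of _ "(d i, w)"]) (auto simp: v_def)
    qed
    then have "\<exists>z\<in>nbhd [] G. \<forall>k\<ge>length ([] :: (nat \<times> nat list \<times> nat) list).
        v (z k) \<in> B \<and> (\<forall>y'\<in>set (pre z k). v y' < v (z k))"
      by (intro nbhd_exists[OF infG])
    then obtain z where z: "z \<in> nbhd [] G"
      "\<And>k. v (z k) \<in> B" "\<And>k y'. y' \<in> set (pre z k) \<Longrightarrow> v y' < v (z k)" by (metis le0 list.size(3))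
    have "strict_mono (\<lambda>k. v (z k))" by (rule strict_monoI) (rule z(3), simp)
    then have "infinite (range (\<lambda>k. v (z k)))"
      by (simp add: strict_mono_imp_inj_on finite_image_iff)
    moreover have "v ` range z = range (\<lambda>k. v (z k))" by blast
    ultimately have "v ` range z \<in> \<B>"
      using her B(1) z(2) unfolding hereditary_def by (metis image_subset_iff rangeE)
    then show ?thesis using z(1) by blast
  qed
  then have good: "v ` range z \<in> \<B>" if "z \<in> nbhd [] G" for z using G(3) that by blast
  define e where "e = enumerate (fst ` G)"
  have e: "e k \<in> fst ` G" "k \<le> e k" for k
    using enumerate_in_set[OF infG] le_enumerate[OF infG] by (simp_all add: e_def)
  have pos: "positive \<B> S" if S: "infinite {k. snd ` (G `` {e k}) \<inter> S \<noteq> {}}" for S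
  proof -
    \<comment> \<open>As \<open>e k\<close> is at least \<open>k\<close>, a set meeting infinitely
      many columns supplies a next entry beyond any bound.\<close>
    have "\<exists>y\<in>G. n < fst y \<and> v y \<in> S" for n
    proof -
      obtain k where k: "n < k" "snd ` (G `` {e k}) \<inter> S \<noteq> {}"
        using S unfolding infinite_nat_iff_unbounded by blast
      then obtain w where "(e k, w) \<in> G" "snd w \<in> S" by blast
      then show ?thesis using k(1) e(2)[of k] by (intro bexI[of _ "(e k, w)"]) (auto simp: v_def)
    qed
    from nbhd_exists[OF infG this, of "[]"] obtain z where z: "z \<in> nbhd [] G" "\<And>k. v (z k) \<in> S"
      by auto
    have "v ` range z \<inter> S = v ` range z" using z(2) by blast
    moreover have "infinite (v ` range z)" using good[OF z(1)] \<B>(1) unfolding Pinf_def by blast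
    ultimately show ?thesis using good[OF z(1)] unfolding positive_def by metis
  qed
  have "G `` {e k} \<subseteq> points_above x p" for k using G(1) unfolding E_def by blast
  then show thesis using that[of "\<lambda>k. G `` {e k}"] bigG[OF e(1)] pos by simp
qed

text \<open>If the values above a node \<open>u\<close> that is not small failed to be positive,
  they would form a set almost disjoint from each member of \<B>. With the generators of all small
  cylinders it would generate the image of \<open>u\<close>: a point \<open>x\<close> of the
  cylinder has a small initial segment, or continuity puts every element of \<open>f x\<close> among
  those values.\<close>

lemma big_exists:
  assumes \<A>: "\<A> \<subseteq> Pinf" and f: "baire_cantor_continuous f" "range f = \<A>"
    and ncg: "\<not> countably_generated_in \<A> (perp \<B>)"
  shows "\<exists>p. big \<B> p \<and> (\<forall>y\<in>p. \<forall>x. pre x (length (fst y)) = fst y \<longrightarrow> snd y \<in> f x)"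
proof -
  define cyl where "cyl u = {x :: nat \<Rightarrow> nat. pre x (length u) = u}" for u
  define small where "small u \<longleftrightarrow> countably_generated_in (f ` cyl u) (perp \<B>)" for u
  define p where "p = {y. \<not> small (fst y) \<and> (\<forall>x\<in>cyl (fst y). snd y \<in> f x)}"
  define Y where "Y u = snd ` {y\<in>p. strict_prefix u (fst y)}" for u
  have "\<forall>u. \<exists>D. small u \<longrightarrow> countable D \<and> D \<subseteq> perp \<B> \<and> (\<forall>A\<in>f ` cyl u. \<exists>F\<in>D. finite (A - F))"
    unfolding small_def countably_generated_in_def by blast
  then obtain D where D: "\<And>u. small u \<Longrightarrow> countable (D u)" "\<And>u. small u \<Longrightarrow> D u \<subseteq> perp \<B>"
    "\<And>u A. small u \<Longrightarrow> A \<in> f ` cyl u \<Longrightarrow> \<exists>F\<in>D u. finite (A - F)" by metis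
  have key: "positive \<B> (Y u)" if u: "\<not> small u" for u
  proof (rule ccontr)
    assume npos: "\<not> positive \<B> (Y u)"
    \<comment> \<open>Members of \<open>perp \<B>\<close> are infinite, so \<open>Y u\<close> is
      added just in that case.\<close>
    define D0 where "D0 = (\<Union>w\<in>{w. small w}. D w) \<union> (if infinite (Y u) then {Y u} else {})"
    have "countable D0" unfolding D0_def using D(1) by auto
    moreover have "D0 \<subseteq> perp \<B>"
    proof -
      have "Y u \<in> perp \<B>" if "infinite (Y u)"
        using npos that unfolding perp_def Pinf_def positive_def orth_def by (simp add: Int_commute)
      then show ?thesis unfolding D0_def using D(2) by auto
    qed
    moreover have "\<exists>F\<in>D0. finite (A - F)" if "A \<in> f ` cyl u" for A
    proof -
      obtain x where x: "x \<in> cyl u" "A = f x" using \<open>A \<in> f ` cyl u\<close> by blast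
      show ?thesis
      proof (cases "\<exists>k. small (pre x k)")
        case True
        then obtain k where k: "small (pre x k)" by blast
        have "f x \<in> f ` cyl (pre x k)" unfolding cyl_def by simp
        then show ?thesis using D(3)[OF k] k x(2) unfolding D0_def by blast
      next
        case False
        have sub: "f x \<subseteq> Y u"
        proof
          fix n assume n: "n \<in> f x"
          obtain m where m: "\<And>y. (\<forall>i<m. y i = x i) \<Longrightarrow> f y \<inter> {..<Suc n} = f x \<inter> {..<Suc n}"
            using f(1) unfolding baire_cantor_continuous_def by metis
          \<comment> \<open>Long enough for continuity to keep \<open>n\<close> in the image, and
            strictly longer than \<open>u\<close>.\<close>
          define k where "k = max m (Suc (length u))"
          have "n \<in> f y" if "y \<in> cyl (pre x k)" for y
          proof -
            have "\<forall>i<m. y i = x i" using that by (auto simp: cyl_def k_def)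
            then show ?thesis using m[of y] n by blast
          qed
          then have "(pre x k, n) \<in> p" using False by (auto simp: p_def)
          moreover have "strict_prefix u (pre x k)"
          proof -
            have "pre x k = u @ map x [length u..<k]"
              using x(1) upt_add_eq_append[of 0 "length u" "k - length u"]
              by (simp add: cyl_def k_def)
            moreover have "length (pre x k) > length u" by (simp add: k_def)
            ultimately show ?thesis by (metis less_irrefl prefixI strict_prefix_def)
          qed
          ultimately show "n \<in> Y u" unfolding Y_def by force
        qed
        have "infinite (f x)" using f(2) \<A> unfolding Pinf_def by blast
        then have "infinite (Y u)" using sub finite_subset by blast
        then have "Y u \<in> D0" by (simp add: D0_def)
        moreover have "A - Y u = {}" using sub x(2) by blast
        then have "finite (A - Y u)" by (simp only: finite.emptyI)
        ultimately show ?thesis by blast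
      qed
    qed
    ultimately have "small u" unfolding small_def countably_generated_in_def
      by (intro exI[of _ D0] conjI ballI)
    then show False using u by blast
  qed
  have "cyl [] = UNIV" by (simp add: cyl_def)
  then have "\<not> small []" using ncg f(2) by (simp add: small_def)
  then have "Y [] \<noteq> {}" using positive_infinite[OF key] infinite_imp_nonempty by blast
  then have "p \<noteq> {}" unfolding Y_def by blast
  moreover have "positive \<B> (snd ` points_above y p)" if "y \<in> p" for y
    using key[of "fst y"] that unfolding Y_def points_above_def p_def by blast
  ultimately have "big \<B> p" unfolding big_def by blast
  then show ?thesis by (intro exI[of _ p]) (auto simp: p_def cyl_def)
qed

section \<open>Branches and infinite fans in the tree of finite sequences\<close>

lemma chain_branch:
  assumes inf: "infinite C" and ch: "\<And>s t. s \<in> C \<Longrightarrow> t \<in> C \<Longrightarrow> prefix s t \<or> prefix t s"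
  shows "\<exists>\<sigma>. \<forall>s\<in>C. pre \<sigma> (length s) = s"
proof -
  have nth: "s ! i = t ! i" if "s \<in> C" "t \<in> C" "i < length s" "i < length t" for s t i
    using ch[OF that(1,2)] that(3,4) by (auto simp: prefix_def nth_append)
  have "inj_on length C"
    by (rule inj_onI) (use ch in \<open>fastforce simp: prefix_def\<close>)
  then have "infinite (length ` C)" using inf by (simp add: finite_image_iff)
  then have "\<forall>i. \<exists>t\<in>C. i < length t" unfolding infinite_nat_iff_unbounded by blast
  then obtain T where T: "\<And>i. T i \<in> C" "\<And>i. i < length (T i)" by metis
  have "pre (\<lambda>i. T i ! i) (length s) = s" if "s \<in> C" for s
    by (rule nth_equalityI) (use nth[OF T(1) that T(2)] in simp_all)
  then show ?thesis by blast
qed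

text \<open>Koenig's lemma: if every node led into \<open>V\<close> through finitely many successors
  only, nodes below infinitely many members of \<open>V\<close> would form an infinite branch, and
  it lies in \<open>T\<close> by downward closure.\<close>

lemma well_founded_infinite_fan:
  assumes T: "T \<in> WF_trees" and V: "V \<subseteq> T" "infinite V"
  shows "\<exists>t. infinite {k. \<exists>s\<in>V. prefix (t @ [k]) s}"
proof (rule ccontr)
  assume "\<not> ?thesis"
  then have fin: "finite {k. \<exists>s\<in>V. prefix (t @ [k]) s}" for t by blast
  have step: "\<exists>k. infinite {s\<in>V. prefix (t @ [k]) s}" if inf: "infinite {s\<in>V. prefix t s}" for t
  proof (rule ccontr)
    assume "\<not> ?thesis"
    then have "finite {s\<in>V. prefix (t @ [k]) s}" for k by blast
    then have "finite (insert t (\<Union>k\<in>{k. \<exists>s\<in>V. prefix (t @ [k]) s}. {s\<in>V. prefix (t @ [k]) s}))"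
      using fin by simp
    moreover have "s \<in> insert t (\<Union>k\<in>{k. \<exists>s\<in>V. prefix (t @ [k]) s}. {s\<in>V. prefix (t @ [k]) s})"
      if s: "s \<in> V" "prefix t s" for s
    proof (cases "s = t")
      case False
      then obtain k r where "s = t @ k # r"
        using s(2) by (metis append.right_neutral neq_Nil_conv prefix_def)
      then have "prefix (t @ [k]) s" by simp
      then show ?thesis using s(1) by blast
    qed simp
    ultimately show False using inf by (metis (no_types, lifting) finite_subset mem_Collect_eq subsetI)
  qed
  have "\<exists>S. \<forall>n. (infinite {s\<in>V. prefix (S n) s} \<and> length (S n) = n) \<and> (\<exists>m. S (Suc n) = S n @ [m])"
  proof (rule dependent_nat_choice)
    show "\<exists>t. infinite {s\<in>V. prefix t s} \<and> length t = 0" using V by (intro exI[of _ "[]"]) simp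
    fix t n assume t: "infinite {s\<in>V. prefix t s} \<and> length t = n"
    then obtain k where "infinite {s\<in>V. prefix (t @ [k]) s}" using step by blast
    then show "\<exists>r. (infinite {s\<in>V. prefix r s} \<and> length r = Suc n) \<and> (\<exists>m. r = t @ [m])"
      using t by (intro exI[of _ "t @ [k]"]) auto
  qed
  then obtain S where S: "\<And>n. infinite {s\<in>V. prefix (S n) s}" "\<And>n. length (S n) = n"
    "\<And>n. \<exists>m. S (Suc n) = S n @ [m]" by blast
  define \<sigma> where "\<sigma> n = last (S (Suc n))" for n
  have S\<sigma>: "pre \<sigma> n = S n" for n
  proof (induction n)
    case 0
    then show ?case using S(2)[of 0] by simp
  next
    case (Suc n)
    then show ?case using S(3)[of n] by (auto simp: \<sigma>_def)
  qed
  have "S n \<in> T" for n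
  proof -
    obtain s where "s \<in> V" "prefix (S n) s" using infinite_imp_nonempty[OF S(1)[of n]] by blast
    moreover have "\<forall>s\<in>T. \<forall>t. prefix t s \<longrightarrow> t \<in> T" using T unfolding WF_trees_def by simp
    ultimately show ?thesis using V(1) by blast
  qed
  then have "\<And>n. pre \<sigma> n \<in> T" using S\<sigma> by simp
  moreover have "\<exists>n. pre \<sigma> n \<notin> T" using T unfolding WF_trees_def by simp
  ultimately show False by blast
qed

section \<open>The embedding of the tree\<close>

text \<open>Each node gets a point and a fan from \<open>big_fan\<close>; the k-th set of the fan
  hosts everything above the k-th successor. The recursion follows \<open>weight\<close> rather than
  the tree order, so that a new value can avoid those at earlier incomparable nodes as well.\<close>

lemma big_tree_embedding:
  assumes \<B>: "\<B> \<subseteq> Pinf" "\<B> \<in> Cmeasurable" "M_family \<B>" and p: "big \<B> p"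
  obtains X :: "nat list \<Rightarrow> nat list \<times> nat" and Q
  where "inj (\<lambda>s. snd (X s))" and "\<And>s. X s \<in> p"
    and "\<And>s k r. prefix (s @ [k]) r \<Longrightarrow> X r \<in> Q s k \<inter> points_above (X s) p"
    and "\<And>s S. infinite {k. snd ` Q s k \<inter> S \<noteq> {}} \<Longrightarrow> positive \<B> S"
proof -
  \<comment> \<open>\<open>g\<close> gives the point and the fan of each node;
    \<open>base g s\<close> is the member of the parent's fan that hosts \<open>s\<close>.\<close>
  define base where "base g s = (if s = [] then p else snd (g (butlast s)) (last s))"
    for g :: "nat list \<Rightarrow> (nat list \<times> nat) \<times> (nat \<Rightarrow> (nat list \<times> nat) set)" and s
  define R where "R g s r \<longleftrightarrow> fst r \<in> base g s \<and>
    (\<forall>t. weight t < weight s \<longrightarrow> snd (fst (g t)) \<noteq> snd (fst r)) \<and>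
    (\<forall>k. big \<B> (snd r k) \<and> snd r k \<subseteq> points_above (fst r) (base g s)) \<and>
    (\<forall>S. infinite {k. snd ` snd r k \<inter> S \<noteq> {}} \<longrightarrow> positive \<B> S)"
    for g :: "nat list \<Rightarrow> (nat list \<times> nat) \<times> (nat \<Rightarrow> (nat list \<times> nat) set)" and s
      and r :: "(nat list \<times> nat) \<times> (nat \<Rightarrow> (nat list \<times> nat) set)"
  have butlast: "weight (butlast s) < weight s" if "s \<noteq> []" for s :: "nat list"
    using weight_snoc[of "butlast s" "last s"] that by simp
  have "\<exists>g. \<forall>s. R g s (g s)"
  \<comment> \<open>A parent has smaller weight, so the requirement at \<open>s\<close> depends on
    \<open>g\<close> only at nodes of smaller weight.\<close>
  proof (rule dependent_wf_choice[of "measure weight"])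
    show "wf (measure weight)" by simp
    fix f g :: "nat list \<Rightarrow> (nat list \<times> nat) \<times> (nat \<Rightarrow> (nat list \<times> nat) set)" and s r
    assume "\<And>t. (t, s) \<in> measure weight \<Longrightarrow> f t = g t"
    then have eq: "f t = g t" if "weight t < weight s" for t using that by simp
    have "base f s = base g s" unfolding base_def using eq[OF butlast] by simp
    then show "R f s r = R g s r" unfolding R_def using eq by simp
  next
    fix s and g :: "nat list \<Rightarrow> (nat list \<times> nat) \<times> (nat \<Rightarrow> (nat list \<times> nat) set)"
    assume "\<And>t. (t, s) \<in> measure weight \<Longrightarrow> R g t (g t)"
    then have prev: "R g t (g t)" if "weight t < weight s" for t using that by simp
    have b: "big \<B> (base g s)"
    proof (cases "s = []")
      case True
      then show ?thesis using p by (simp add: base_def)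
    next
      case False
      then show ?thesis using prev[OF butlast[OF False]] unfolding R_def base_def[of g s] by simp
    qed
    define used where "used = (\<lambda>t. snd (fst (g t))) ` {t. weight t < weight s}"
    have "finite used" unfolding used_def using finite_weight_less by blast
    then have "infinite (snd ` base g s - used)"
      using positive_infinite[OF big_positive[OF b]] by (rule Diff_infinite_finite)
    then obtain n where n: "n \<in> snd ` base g s" "n \<notin> used"
      by (metis Diff_iff ex_in_conv finite.emptyI)
    then obtain x where x: "x \<in> base g s" "n = snd x" by blast
    have new: "snd (fst (g t)) \<noteq> snd x" if "weight t < weight s" for t
      using n(2) x(2) that unfolding used_def by (metis (mono_tags, lifting) image_eqI mem_Collect_eq)
    obtain q :: "nat \<Rightarrow> _" where "\<And>k. big \<B> (q k)" "\<And>k. q k \<subseteq> points_above x (base g s)"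
      "\<And>S. infinite {k. snd ` q k \<inter> S \<noteq> {}} \<Longrightarrow> positive \<B> S"
      by (rule big_fan[OF \<B> b x(1)]) (rule that)
    then have "R g s (x, q)" unfolding R_def using x(1) new by simp
    then show "\<exists>r. R g s r" by blast
  qed
  then obtain g where g: "\<And>s. R g s (g s)" by blast
  define X where "X s = fst (g s)" for s
  define Q where "Q s = snd (g s)" for s
  have Xb: "X s \<in> base g s" for s using g[of s] unfolding R_def X_def by blast
  have Qb: "Q s k \<subseteq> points_above (X s) (base g s)" for s k using g[of s] unfolding R_def X_def Q_def by blast
  have base_snoc: "base g (s @ [k]) = Q s k" for s k by (simp add: base_def Q_def)
  have base_append: "base g (s @ t) \<subseteq> base g s" for s t
  proof (induction t rule: rev_induct)
    case (snoc k t)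
    have "base g (s @ t @ [k]) \<subseteq> base g (s @ t)"
      using base_snoc[of "s @ t" k] Qb[of "s @ t" k] points_above_subset by fastforce
    then show ?case using snoc by blast
  qed simp
  have inj_X: "inj (\<lambda>s. snd (X s))"
  proof (rule injI, rule ccontr)
    fix s t assume eq: "snd (X s) = snd (X t)" and "s \<noteq> t"
    then have "weight s < weight t \<or> weight t < weight s" using inj_weight by (metis injD nat_neq_iff)
    then show False using g[of s] g[of t] eq unfolding R_def X_def by metis
  qed
  have in_p: "base g s \<subseteq> p" for s using base_append[of "[]" s] by (simp add: base_def)
  then have "X s \<in> p" for s using Xb by blast
  moreover have "X r \<in> Q s k \<inter> points_above (X s) p" if "prefix (s @ [k]) r" for s k r
  proof -
    have "X r \<in> Q s k" using Xb[of r] base_append that base_snoc[of s k] unfolding prefix_def by blast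
    then show ?thesis using Qb[of s k] in_p[of s] unfolding points_above_def by blast
  qed
  moreover have "positive \<B> S" if "infinite {k. snd ` Q s k \<inter> S \<noteq> {}}" for s S
    using g[of s] that unfolding R_def Q_def by blast
  ultimately show thesis by (rule that[OF inj_X])
qed

theorem mainTheorem2:
  fixes \<A> \<B> :: "nat set set"
  assumes "\<A> \<subseteq> Pinf" and "\<B> \<subseteq> Pinf"
    and "hereditary \<A>" and "hereditary \<B>"
    and "orth_fam \<A> \<B>"
    and "analytic \<A>"
    and "\<B> \<in> Cmeasurable" and "M_family \<B>"
  shows "countably_generated_in \<A> (perp \<B>)
    \<or> (\<exists>\<psi> :: nat list \<Rightarrow> nat. inj \<psi>
          \<and> tree_chains \<subseteq> {\<psi> -` A | A. A \<in> \<A>}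
          \<and> I_wf \<subseteq> {\<psi> -` B | B. B \<in> perp (perp \<B>)})"
proof (cases "countably_generated_in \<A> (perp \<B>)")
  case False
  \<comment> \<open>The empty family is vacuously countably generated, so \<A> is parametrised by
    the Baire space.\<close>
  then have "\<A> \<noteq> {}" unfolding countably_generated_in_def by auto
  then obtain f where f: "baire_cantor_continuous f" "range f = \<A>"
    using assms(6) unfolding analytic_def by blast
  obtain p where p: "big \<B> p"
    and pf: "\<And>y x. y \<in> p \<Longrightarrow> pre x (length (fst y)) = fst y \<Longrightarrow> snd y \<in> f x"
    using big_exists[OF assms(1) f False] by blast
  obtain X Q where inj: "inj (\<lambda>s :: nat list. snd (X s))" and Xp: "\<And>s. X s \<in> p"
    and X: "\<And>s k r. prefix (s @ [k]) r \<Longrightarrow> X r \<in> Q s k \<inter> points_above (X s) p"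
    and Q: "\<And>s S. infinite {k. snd ` Q s k \<inter> S \<noteq> {}} \<Longrightarrow> positive \<B> S"
    by (rule big_tree_embedding[OF assms(2,7,8) p]) (rule that)
  define \<psi> where "\<psi> s = snd (X s)" for s
  have inj_\<psi>: "inj \<psi>" using inj by (simp add: \<psi>_def[abs_def])
  have inf_image: "infinite (\<psi> ` W)" if "infinite W" for W
    using that inj_\<psi> by (simp add: finite_image_iff inj_on_subset)
  have "C \<in> {\<psi> -` A | A. A \<in> \<A>}" if C: "C \<in> tree_chains" for C
  proof -
    have infC: "infinite C" and ch: "\<And>s t. s \<in> C \<Longrightarrow> t \<in> C \<Longrightarrow> prefix s t \<or> prefix t s"
      using C unfolding tree_chains_def by blast+
    \<comment> \<open>Points along a chain of nodes have increasing first components. A single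
      branch \<open>\<sigma>\<close> therefore passes through all of these, and the values all lie
      in \<open>f \<sigma>\<close>.\<close>
    have mono: "strict_prefix (fst (X s)) (fst (X t))" if st: "strict_prefix s t" for s t
    proof -
      obtain k r where "t = s @ k # r" using st by (rule strict_prefixE')
      then have "prefix (s @ [k]) t" by simp
      then show ?thesis using X unfolding points_above_def by blast
    qed
    have "inj_on (\<lambda>s. fst (X s)) C"
      by (rule inj_onI) (metis ch mono prefix_order.le_less prefix_order.less_irrefl)
    then have "infinite ((\<lambda>s. fst (X s)) ` C)" using infC by (simp add: finite_image_iff)
    moreover have "prefix u w \<or> prefix w u"
      if "u \<in> (\<lambda>s. fst (X s)) ` C" "w \<in> (\<lambda>s. fst (X s)) ` C" for u w
      using that ch mono by (auto simp: prefix_order.le_less)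
    ultimately obtain \<sigma> where \<sigma>: "\<And>s. s \<in> C \<Longrightarrow> pre \<sigma> (length (fst (X s))) = fst (X s)"
      using chain_branch[of "(\<lambda>s. fst (X s)) ` C"] by blast
    have "\<psi> ` C \<subseteq> f \<sigma>" using pf[OF Xp \<sigma>] unfolding \<psi>_def by blast
    then have "\<psi> ` C \<in> \<A>" using assms(3) f(2) inf_image[OF infC] unfolding hereditary_def by blast
    moreover have "C = \<psi> -` (\<psi> ` C)" by (simp add: inj_vimage_image_eq[OF inj_\<psi>])
    ultimately show ?thesis by blast
  qed
  moreover have "W \<in> {\<psi> -` B | B. B \<in> perp (perp \<B>)}" if W: "W \<in> I_wf" for W
  proof -
    obtain T where T: "T \<in> WF_trees" "W \<subseteq> T" and infW: "infinite W" using W unfolding I_wf_def by blast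
    have "finite (\<psi> ` W \<inter> D)" if D: "D \<in> perp \<B>" for D
    proof (rule ccontr)
      assume inf: "infinite (\<psi> ` W \<inter> D)"
      \<comment> \<open>The nodes sent into \<open>D\<close> leave some \<open>t\<close> through
        infinitely many successors. So \<open>D\<close> meets infinitely many sets of the fan at
        \<open>t\<close> and is positive, contrary to its orthogonality to \<B>.\<close>
      define V where "V = {s\<in>W. \<psi> s \<in> D}"
      have "\<psi> ` V = \<psi> ` W \<inter> D" by (auto simp: V_def)
      then have "infinite V" using inf by (metis finite_imageI)
      moreover have "V \<subseteq> T" using T(2) by (auto simp: V_def)
      ultimately obtain t where t: "infinite {k. \<exists>s\<in>V. prefix (t @ [k]) s}"
        using well_founded_infinite_fan[OF T(1)] by blast
      have "{k. \<exists>s\<in>V. prefix (t @ [k]) s} \<subseteq> {k. snd ` Q t k \<inter> D \<noteq> {}}"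
        using X unfolding V_def \<psi>_def by blast
      then have "infinite {k. snd ` Q t k \<inter> D \<noteq> {}}" using t finite_subset by blast
      then have "positive \<B> D" by (rule Q)
      then show False using D unfolding positive_def perp_def orth_def by (auto simp: Int_commute)
    qed
    then have "\<psi> ` W \<in> perp (perp \<B>)"
      using inf_image[OF infW] by (simp add: perp_def[of "perp \<B>"] Pinf_def orth_def)
    moreover have "W = \<psi> -` (\<psi> ` W)" by (simp add: inj_vimage_image_eq[OF inj_\<psi>])
    ultimately show ?thesis by blast
  qed
  ultimately show ?thesis using inj_\<psi> by blast
qed blast

end
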